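(* Let $\ell\ge1$ be an integer, let $\widehat{\bf y}_{\ell,k}(t)=V_k\varphi_\ell(-tT_k)\beta{\bf e}_1$, and let $$\widehat{\bf r}_{\ell,k}(t)=-A\widehat{\bf y}_{\ell,k}(t)-\frac{\ell}{t}\widehat{\bf y}_{\ell,k}(t)+\frac{1}{t(\ell-1)!}{\bf v}-\widehat{\bf y}_{\ell,k}'(t).$$ Then $$ \widehat{\bf r}_{\ell,k}(t)=\frac{1}{t}\Big[-tAV_{k}\varphi_{\ell}(-tT_{k})\beta{\bf e}_{1}-V_{k}\varphi_{\ell-1}(-tT_{k})\beta{\bf e}_{1}+\frac{1}{(\ell-1)!}V_{k}\beta{\bf e}_{1}\Big] =V_{k+1}\begin{bmatrix}\gamma h_{k+1,k}^{2}(I+\gamma H_{k})^{-\mathrm{H}}{\bf e}_{k}\\ -h_{k+1,k}\end{bmatrix}\big[{\bf e}_{k}^{\mathrm{H}}\varphi_{\ell}(-tT_{k})\beta{\bf e}_{1}\big], $$ and $$ [(I+\gamma A)V_{k}]^{\mathrm{H}}\,\widehat{\bf r}_{\ell,k}(t)={\bf 0}. $$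
   Context: The $\varphi$-functions are $\varphi_0(z)=e^z$ and $\varphi_\ell(z)=\frac{1}{(\ell-1)!}\int_0^1 e^{(1-\theta)z}\theta^{\ell-1}d\theta$ for $\ell\ge1$, $z\in\mathbb C$ (entire functions, extended to square matrices as matrix functions). $A$ is an $n\times n$ matrix, $t>0$, the spectrum of $-tA$ lies in the (closed) left half plane, and ${\bf v}$ is a nonzero vector with $\beta=\|{\bf v}\|_2$. The $k$-step Arnoldi process started with ${\bf v}_1={\bf v}/\beta$ is assumed to produce $V_{k+1}=[{\bf v}_1,\dots,{\bf v}_{k+1}]=[V_k,{\bf v}_{k+1}]$ with orthonormal columns (spanning the Krylov subspace $\mathrm{span}\{{\bf v}_1,A{\bf v}_1,\dots,A^k{\bf v}_1\}$), a $k\times k$ upper Hessenberg matrix $H_k$ and a real scalar $h_{k+1,k}$ with $$AV_k=V_kH_k+h_{k+1,k}{\bf v}_{k+1}{\bf e}_k^{\mathrm{H}}.$$ Here ${\bf e}_j$ is the $j$-th column of the $k\times k$ identity matrix, $(\cdot)^{\mathrm{H}}$ is the conjugate transpose, $(\cdot)^{-\mathrm{H}}$ is the inverse of the conjugate transpose, and $'$ denotes $d/dt$. The parameter $\gamma$ is a nonzero real number such that $I+\gamma H_k$ is nonsingular, and $$T_k=H_k+\gamma h_{k+1,k}^2(I+\gamma H_k)^{-\mathrm{H}}{\bf e}_k{\bf e}_k^{\mathrm{H}}.$$ *)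

theory Defs
  imports "HOL-Analysis.Analysis" "Jordan_Normal_Form.Spectral_Radius"
    "Jordan_Normal_Form.Schur_Decomposition"
begin

text \<open>
  Indices start at 0 in \<open>Jordan_Normal_Form\<close>: the mathematical \<open>e\<^sub>j\<close> is
  \<open>unit_vec k (j - 1)\<close>. The product \<open>w\<^sup>H x\<close> is \<open>x \<bullet>c w\<close>, which conjugates
  its second argument.
\<close>

fun phi :: "nat \<Rightarrow> complex \<Rightarrow> complex" where
  "phi 0 z = exp z"
| "phi (Suc m) z = 1 / fact m *
     integral {0..1} (\<lambda>\<theta>::real. exp (of_real (1 - \<theta>) * z) * of_real \<theta> ^ m)"

text \<open>
  The matrix function of an entire function \<open>f\<close> is its Taylor series at 0, summed
  entrywise. The argument is meant to be square. For non-entire \<open>f\<close> the series need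
  not converge.
\<close>

definition mat_fun :: "(complex \<Rightarrow> complex) \<Rightarrow> complex mat \<Rightarrow> complex mat" where
  "mat_fun f M = Matrix.mat (dim_row M) (dim_row M)
     (\<lambda>(r, c). \<Sum>j. (deriv ^^ j) f 0 / fact j * (M ^\<^sub>m j) $$ (r, c))"

definition vec_l2norm :: "complex vec \<Rightarrow> real" where
  "vec_l2norm v = L2_set (\<lambda>i. norm (vec_index v i)) {..<dim_vec v}"

definition vec_deriv :: "(real \<Rightarrow> complex vec) \<Rightarrow> real \<Rightarrow> complex vec" where
  "vec_deriv y t =
     Matrix.vec (dim_vec (y t)) (\<lambda>i. vector_derivative (\<lambda>s. vec_index (y s) i) (at t))"

text \<open>The rank-one matrix \<open>u w\<^sup>H\<close>.\<close>

definition outer_prod :: "complex vec \<Rightarrow> complex vec \<Rightarrow> complex mat" where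
  "outer_prod u w =
     Matrix.mat (dim_vec u) (dim_vec w) (\<lambda>(i, j). vec_index u i * cnj (vec_index w j))"

text \<open>\<open>M\<^sup>-\<^sup>H\<close>, for nonsingular \<open>M\<close> only.\<close>

definition inv_adjoint :: "complex mat \<Rightarrow> complex mat" where
  "inv_adjoint M = the (mat_inverse (mat_adjoint M))"

definition append_col :: "complex mat \<Rightarrow> complex vec \<Rightarrow> complex mat" where
  "append_col V w = mat_of_cols (dim_row V) (cols V @ [w])"

definition orthonormal_cols :: "complex mat \<Rightarrow> bool" where
  "orthonormal_cols W \<longleftrightarrow>
     (\<forall>i<dim_col W. \<forall>j<dim_col W. col W i \<bullet>c col W j = (if i = j then 1 else 0))"

definition upper_hessenberg :: "complex mat \<Rightarrow> bool" where
  "upper_hessenberg H \<longleftrightarrow>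
     (\<forall>i<dim_row H. \<forall>j<dim_col H. j + 1 < i \<longrightarrow> H $$ (i, j) = 0)"

text \<open>The span of \<open>b, A b, \<dots>, A\<^bsup>m-1\<^esup> b\<close>.\<close>

definition krylov_subspace :: "complex mat \<Rightarrow> complex vec \<Rightarrow> nat \<Rightarrow> complex vec set" where
  "krylov_subspace A b m =
     LinearCombinations.module.span class_ring (module_vec TYPE(complex) (dim_row A))
       ((\<lambda>j. (A ^\<^sub>m j) *\<^sub>v b) ` {..<m})"

text \<open>
  The outcome of \<open>k\<close> steps of the Arnoldi process for \<open>A\<close> started with the unit vector
  \<open>b\<close>: \<open>V = [v\<^sub>1, \<dots>, v\<^sub>k]\<close>, \<open>w = v\<^bsub>k+1\<^esub>\<close>, and \<open>h = h\<^bsub>k+1,k\<^esub>\<close>.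
\<close>

definition arnoldi ::
  "complex mat \<Rightarrow> complex vec \<Rightarrow> nat \<Rightarrow> complex mat \<Rightarrow> complex vec \<Rightarrow> complex mat \<Rightarrow> real \<Rightarrow> bool"
  where
  "arnoldi A b k V w H h \<longleftrightarrow>
     1 \<le> k \<and>
     V \<in> carrier_mat (dim_row A) k \<and> w \<in> carrier_vec (dim_row A) \<and> H \<in> carrier_mat k k \<and>
     col V 0 = b \<and>
     orthonormal_cols (append_col V w) \<and>
     LinearCombinations.module.span class_ring (module_vec TYPE(complex) (dim_row A))
       (set (cols (append_col V w))) = krylov_subspace A b (k + 1) \<and>
     upper_hessenberg H \<and>
     A * V = V * H + of_real h \<cdot>\<^sub>m outer_prod w (unit_vec k (k - 1))"

end

theory Submission
  imports Defs
begin

text \<open>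
  Integration by parts gives \<open>z \<phi>\<^bsub>m+1\<^esub>(z) + 1/m! = \<phi>\<^sub>m(z)\<close>, hence the Taylor coefficients
  \<open>1/(j+l)!\<close> of \<open>\<phi>\<^sub>l\<close>. Comparing coefficients, the matrix functions satisfy the same recurrence and
  \<open>t d/dt \<phi>\<^sub>l(-tT) = \<phi>\<^bsub>l-1\<^esub>(-tT) - l \<phi>\<^sub>l(-tT)\<close>, which yields the first formula for the residual.
  Substituting the Arnoldi relation for \<open>A V\<close> and the recurrence at \<open>-tT\<close> cancels everything except the
  rank-one terms, which gives the second. Finally \<open>(I + \<gamma>A)V = V(I + \<gamma>H) + \<gamma>h w e\<^sub>k\<^sup>H\<close>, and
  orthonormality of \<open>[V, w]\<close> makes the two contributions \<open>\<plusminus>\<gamma>h\<^sup>2 e\<^sub>k\<close> cancel.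
\<close>

unbundle no vec_syntax

text \<open>The simplifier would rewrite even an unapplied \<open>phi (Suc m)\<close>, after eta-expansion.\<close>

declare phi.simps(2) [simp del]

subsection \<open>Taylor series of the \<open>\<phi>\<close>-functions\<close>

text \<open>Integrating the derivative of \<open>E \<theta> * \<theta> ^ m\<close> over [0,1] gives
  both integrals at once. Without division by \<open>z\<close> the identity also covers
  \<open>z = 0\<close>.\<close>

lemma phi_rec: "z * phi (Suc m) z + 1 / fact m = phi m z"
proof -
  define E where "E = (\<lambda>\<theta>::real. exp (of_real (1 - \<theta>) * z))"
  have int: "(\<lambda>\<theta>. E \<theta> * of_real \<theta> ^ i) integrable_on {0..1}" for i
    unfolding E_def by (intro integrable_continuous_interval continuous_intros)
  have int_phi: "integral {0..1} (\<lambda>\<theta>. E \<theta> * of_real \<theta> ^ i) = fact i * phi (Suc i) z" for i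
    by (simp add: E_def phi.simps(2))
  \<comment> \<open>The derivative is taken in a complex variable and then restricted to the real
    segment. At \<open>m = 0\<close> the truncated exponent \<open>m - 1\<close> is harmless because
    of the factor \<open>of_nat m\<close>.\<close>
  have "((\<lambda>w. exp ((1 - w) * z) * w ^ m) has_field_derivative
      (- z * (exp ((1 - w) * z) * w ^ m) + of_nat m * (exp ((1 - w) * z) * w ^ (m - 1)))) (at w)" for w
    by (auto intro!: derivative_eq_intros simp: algebra_simps)
  from has_vector_derivative_real_field[OF this]
  have D: "((\<lambda>\<theta>. E \<theta> * of_real \<theta> ^ m) has_vector_derivative
      (- z * (E \<theta> * of_real \<theta> ^ m) + of_nat m * (E \<theta> * of_real \<theta> ^ (m - 1)))) (at \<theta> within {0..1})" for \<theta>
    by (simp add: E_def)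
  have "((\<lambda>\<theta>. - z * (E \<theta> * of_real \<theta> ^ m) + of_nat m * (E \<theta> * of_real \<theta> ^ (m - 1)))
      has_integral (E 1 * of_real 1 ^ m - E 0 * of_real 0 ^ m)) {0..1}"
    by (intro fundamental_theorem_of_calculus D) auto
  moreover have "((\<lambda>\<theta>. - z * (E \<theta> * of_real \<theta> ^ m) + of_nat m * (E \<theta> * of_real \<theta> ^ (m - 1)))
      has_integral (- z * (fact m * phi (Suc m) z) + of_nat m * (fact (m - 1) * phi (Suc (m - 1)) z))) {0..1}"
    unfolding int_phi[symmetric]
    by (intro has_integral_add has_integral_mult_right integrable_integral int)
  ultimately have "- z * (fact m * phi (Suc m) z) + of_nat m * (fact (m - 1) * phi (Suc (m - 1)) z)
      = E 1 * of_real 1 ^ m - E 0 * of_real 0 ^ m"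
    by (rule has_integral_unique[rotated])
  \<comment> \<open>The boundary values are \<open>E 1 = 1\<close> and \<open>E 0 = exp z\<close>.
    The factor \<open>0 ^ m\<close> is 1 for \<open>m = 0\<close> and 0 otherwise, which forces the
    case split below.\<close>
  then have eq: "of_nat m * (fact (m - 1) * phi (Suc (m - 1)) z) - fact m * (z * phi (Suc m) z)
      = 1 - exp z * 0 ^ m"
    by (simp add: E_def mult.left_commute)
  show ?thesis
  proof (cases m)
    case 0
    with eq show ?thesis by (simp add: algebra_simps)
  next
    case (Suc i)
    then have "of_nat m * (fact (m - 1) * phi (Suc (m - 1)) z) = fact m * phi m z"
      by (simp add: mult.assoc)
    with eq have "fact m * (phi m z - z * phi (Suc m) z) = 1 - exp z * 0 ^ m"
      by (simp only: right_diff_distrib)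
    then have "phi m z - z * phi (Suc m) z = 1 / fact m"
      using Suc by (simp add: eq_divide_eq mult.commute del: fact_Suc)
    then show ?thesis by (simp add: diff_eq_eq add.commute)
  qed
qed

text \<open>Starting from the exponential series, each induction step removes the constant term and
  divides by \<open>z\<close>, as \<open>phi_rec\<close> prescribes. At \<open>z = 0\<close>, where
  division fails, only the constant term survives.\<close>

lemma phi_sums: "(\<lambda>j. 1 / fact (j + l) * z ^ j) sums phi l z"
proof (cases "z = 0")
  case True
  have "phi l 0 = 1 / fact l"
    using phi_rec[of 0 l] by simp
  then show ?thesis
    using True powser_sums_zero[of "\<lambda>j. 1 / fact (j + l) :: complex"] by simp
next
  case False
  show ?thesis
  proof (induction l)
    case 0
    show ?case
      using exp_converges[of z] by (simp add: scaleR_conv_of_real divide_inverse)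
  next
    case (Suc l)
    from Suc have "(\<lambda>j. 1 / fact (Suc j + l) * z ^ Suc j) sums (phi l z - 1 / fact l)"
      by (subst sums_Suc_iff) simp
    then have "(\<lambda>j. 1 / fact (Suc j + l) * z ^ Suc j / z) sums ((phi l z - 1 / fact l) / z)"
      by (rule sums_divide)
    then show ?case
      using False by (simp add: phi_rec[of z l, symmetric] del: fact_Suc)
  qed
qed

text \<open>A convergent expansion determines the derivatives at 0. This replaces the iterated
  derivatives in \<open>mat_fun\<close> by explicit coefficients.\<close>

lemma phi_taylor_coeff: "(deriv ^^ j) (phi l) 0 / fact j = 1 / fact (j + l)"
proof -
  have "phi l has_fps_expansion Abs_fps (\<lambda>j. 1 / fact (j + l))"
    by (rule has_fps_expansionI) (use phi_sums in simp)
  from fps_nth_fps_expansion[OF this, of j] show ?thesis by simp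
qed

text \<open>The factorial beats any geometric growth: the exponential series at
  \<open>C * norm x\<close> is a majorant.\<close>

lemma summable_phi_series:
  fixes a :: "nat \<Rightarrow> complex"
  assumes "\<And>j. norm (a j) \<le> C ^ j"
  shows "summable (\<lambda>j. 1 / fact (j + l) * a j * x ^ j)"
proof (rule summable_comparison_test')
  show "summable (\<lambda>j. inverse (fact j) * (C * norm x) ^ j)"
    using summable_exp[of "C * norm x"] by simp
  fix j :: nat
  have "1 / fact (j + l) * norm (a j) * norm x ^ j \<le> 1 / fact j * C ^ j * norm x ^ j"
    using assms[of j] by (intro mult_mono mult_right_mono) (auto simp: frac_le fact_mono intro: order_trans[OF norm_ge_zero])
  then show "norm (1 / fact (j + l) * a j * x ^ j) \<le> inverse (fact j) * (C * norm x) ^ j"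
    by (simp add: norm_mult norm_divide norm_power field_simps)
qed

text \<open>With \<open>a j\<close> an entry of the \<open>j\<close>-th power of \<open>T\<close>,
  \<open>S l x\<close> is that entry of the matrix function \<open>phi l\<close> at \<open>x\<close>
  times \<open>T\<close>. The coefficients match because j/(j+m+1)! = 1/(j+m)! -
  (m+1)/(j+m+1)!.\<close>

lemma phi_series_deriv:
  fixes a :: "nat \<Rightarrow> complex"
  assumes "\<And>j. norm (a j) \<le> C ^ j" and "x \<noteq> 0"
  defines "S \<equiv> \<lambda>l x. \<Sum>j. 1 / fact (j + l) * a j * x ^ j"
  shows "(S (Suc m) has_field_derivative (S m x - of_nat (Suc m) * S (Suc m) x) / x) (at x)"
proof -
  define c where "c = (\<lambda>j. 1 / fact (j + Suc m) * a j)"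
  have summable: "summable (\<lambda>j. 1 / fact (j + l) * a j * x ^ j)" for l x
    by (rule summable_phi_series[OF assms(1)])
  have D: "(S (Suc m) has_field_derivative (\<Sum>j. diffs c j * x ^ j)) (at x)"
    unfolding S_def c_def
    by (rule termdiffs_strong_converges_everywhere) (rule summable)
  have "summable (\<lambda>j. diffs c j * x ^ j)"
    unfolding c_def by (rule termdiff_converges_all summable)+
  \<comment> \<open>Multiplication by \<open>x\<close> restores the exponent \<open>j\<close>
    lowered by differentiation; the term \<open>j = 0\<close> vanishes through its factor
    \<open>of_nat j\<close>.\<close>
  from sums_mult[OF diffs_equiv[OF this], of x]
  have 1: "(\<lambda>j. of_nat j * c j * x ^ j) sums (x * (\<Sum>j. diffs c j * x ^ j))"
    by (rule sums_cong[THEN iffD1, rotated]) (auto simp: gr0_conv_Suc split: nat.splits)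
  have "(\<lambda>j. 1 / fact (j + m) * a j * x ^ j - of_nat (Suc m) * (1 / fact (j + Suc m) * a j * x ^ j))
     sums (S m x - of_nat (Suc m) * S (Suc m) x)"
    unfolding S_def by (intro sums_diff sums_mult summable_sums summable)
  also have "(\<lambda>j. 1 / fact (j + m) * a j * x ^ j - of_nat (Suc m) * (1 / fact (j + Suc m) * a j * x ^ j))
    = (\<lambda>j. of_nat j * c j * x ^ j)"
  proof
    fix j
    have "(1 / fact (j + m) :: complex) = (of_nat j + of_nat (Suc m)) * (1 / fact (j + Suc m))"
      by (simp add: field_simps del: of_nat_Suc) (simp add: algebra_simps)
    then show "1 / fact (j + m) * a j * x ^ j - of_nat (Suc m) * (1 / fact (j + Suc m) * a j * x ^ j)
       = of_nat j * c j * x ^ j"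
      unfolding c_def by (simp only: ring_distribs mult.assoc add_diff_cancel_right')
  qed
  finally have "x * (\<Sum>j. diffs c j * x ^ j) = S m x - of_nat (Suc m) * S (Suc m) x"
    using 1 sums_unique2 by blast
  then show ?thesis
    using D \<open>x \<noteq> 0\<close> by (metis nonzero_mult_div_cancel_left)
qed

subsection \<open>Matrix \<open>\<phi>\<close>-functions\<close>

lemma mult_mat_vec_index_sum:
  assumes "X \<in> carrier_mat p q" "x \<in> carrier_vec q" "i < p"
  shows "(X *\<^sub>v x) $ i = (\<Sum>j<q. X $$ (i, j) * x $ j)"
  using assms by (simp add: scalar_prod_def lessThan_atLeast0)

lemma mult_mat_index_sum:
  assumes "X \<in> carrier_mat p q" "Y \<in> carrier_mat q s" "i < p" "c < s"
  shows "(X * Y) $$ (i, c) = (\<Sum>j<q. X $$ (i, j) * Y $$ (j, c))"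
  using assms by (simp add: scalar_prod_def lessThan_atLeast0)

lemma smult_pow_mat:
  fixes T :: "'a :: comm_semiring_1 mat"
  assumes "T \<in> carrier_mat k k"
  shows "(x \<cdot>\<^sub>m T) ^\<^sub>m j = x ^ j \<cdot>\<^sub>m (T ^\<^sub>m j)"
proof (induction j)
  case (Suc j)
  have C: "T ^\<^sub>m j \<in> carrier_mat k k"
    by (rule pow_carrier_mat[OF assms])
  have "(x \<cdot>\<^sub>m T) ^\<^sub>m Suc j = (x ^ j \<cdot>\<^sub>m (T ^\<^sub>m j)) * (x \<cdot>\<^sub>m T)"
    by (simp add: Suc)
  also have "\<dots> = x ^ j \<cdot>\<^sub>m (x \<cdot>\<^sub>m (T ^\<^sub>m j * T))"
    using C assms by (simp add: mult_smult_assoc_mat[OF C smult_carrier_mat[OF assms]] mult_smult_distrib[OF C assms])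
  also have "\<dots> = x ^ Suc j \<cdot>\<^sub>m (T ^\<^sub>m Suc j)"
    by (rule eq_matI) (simp_all add: mult_ac)
  finally show ?case .
next
  case 0
  show ?case by (rule eq_matI) (use assms in simp_all)
qed

text \<open>The recursion of \<open>pow_mat\<close> multiplies on the right, whereas
  \<open>mat_fun_phi_rec\<close> has the factor \<open>T\<close> on the left.\<close>

lemma pow_mat_Suc_left:
  assumes "T \<in> carrier_mat k k"
  shows "T ^\<^sub>m Suc j = T * T ^\<^sub>m j"
proof (induction j)
  case (Suc j)
  have "T ^\<^sub>m Suc (Suc j) = T * T ^\<^sub>m j * T"
    using Suc by simp
  also have "\<dots> = T * T ^\<^sub>m Suc j"
    using assms by (simp add: assoc_mult_mat[OF assms pow_carrier_mat[OF assms] assms])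
  finally show ?case .
qed (use assms in simp)

text \<open>Each column sum of norms is at most the sum over all entries, so one more factor
  \<open>T\<close> costs at most that constant. This is the geometric bound that the series lemmas
  assume.\<close>

lemma norm_pow_mat_index_le:
  fixes T :: "complex mat"
  assumes T: "T \<in> carrier_mat k k" and "r < k" "c < k"
  shows "norm ((T ^\<^sub>m j) $$ (r, c)) \<le> (\<Sum>p<k. \<Sum>q<k. norm (T $$ (p, q))) ^ j"
  using \<open>c < k\<close>
proof (induction j arbitrary: c)
  case 0
  then show ?case using T \<open>r < k\<close> by simp
next
  case (Suc j)
  let ?C = "\<Sum>p<k. \<Sum>q<k. norm (T $$ (p, q))"
  have "norm ((T ^\<^sub>m Suc j) $$ (r, c)) = norm (\<Sum>p<k. (T ^\<^sub>m j) $$ (r, p) * T $$ (p, c))"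
    using mult_mat_index_sum[OF pow_carrier_mat[OF T] T \<open>r < k\<close> Suc.prems] by simp
  also have "\<dots> \<le> (\<Sum>p<k. ?C ^ j * norm (T $$ (p, c)))"
    by (intro sum_norm_le) (auto simp: norm_mult intro!: mult_right_mono Suc.IH)
  also have "\<dots> \<le> (\<Sum>p<k. ?C ^ j * (\<Sum>q<k. norm (T $$ (p, q))))"
    using Suc.prems
    by (intro sum_mono mult_left_mono member_le_sum[where f = "\<lambda>q. norm (T $$ (_, q))"])
      (auto intro!: sum_nonneg zero_le_power)
  also have "\<dots> = ?C ^ Suc j"
    by (simp add: sum_distrib_left[symmetric])
  finally show ?case .
qed

section \<open>Entries, recurrence and derivative of the matrix phi-functions\<close>

lemma mat_fun_dim [simp]: "dim_row (mat_fun f T) = dim_row T" "dim_col (mat_fun f T) = dim_row T"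
  by (simp_all add: mat_fun_def)

lemma mat_fun_carrier [simp]: "T \<in> carrier_mat k k \<Longrightarrow> mat_fun f T \<in> carrier_mat k k"
  by (simp add: mat_fun_def)

text \<open>Pulling \<open>x\<close> out of the powers makes each entry a scalar power series in
  \<open>x\<close>, so that it can be differentiated in \<open>x\<close>.\<close>

lemma mat_fun_phi_index:
  assumes "T \<in> carrier_mat k k" "r < k" "c < k"
  shows "mat_fun (phi l) (x \<cdot>\<^sub>m T) $$ (r, c) = (\<Sum>j. 1 / fact (j + l) * (T ^\<^sub>m j) $$ (r, c) * x ^ j)"
  using assms pow_carrier_mat[OF assms(1)]
  by (simp add: mat_fun_def phi_taylor_coeff smult_pow_mat[OF assms(1)] mult_ac)

text \<open>Multiplying the series of \<open>phi (Suc m)\<close> by \<open>T\<close> shifts it by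
  one index; what is missing from the series of \<open>phi m\<close> is its term
  \<open>j = 0\<close>, the scaled identity.\<close>

lemma mat_fun_phi_rec:
  assumes T: "T \<in> carrier_mat k k"
  shows "mat_fun (phi m) T = (1 / fact m) \<cdot>\<^sub>m 1\<^sub>m k + T * mat_fun (phi (Suc m)) T"
proof (rule eq_matI)
  fix r c
  assume "r < dim_row ((1 / fact m) \<cdot>\<^sub>m 1\<^sub>m k + T * mat_fun (phi (Suc m)) T)"
    and "c < dim_col ((1 / fact m) \<cdot>\<^sub>m 1\<^sub>m k + T * mat_fun (phi (Suc m)) T)"
  then have rc: "r < k" "c < k"
    using T by (auto simp: mat_fun_def)
  have idx: "mat_fun (phi l) T $$ (p, c) = (\<Sum>j. 1 / fact (j + l) * (T ^\<^sub>m j) $$ (p, c))" if "p < k" for l p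
    using T that rc by (simp add: mat_fun_def phi_taylor_coeff)
  have summable: "summable (\<lambda>j. 1 / fact (j + l) * (T ^\<^sub>m j) $$ (p, c))" if "p < k" for l p
    using summable_phi_series[of "\<lambda>j. (T ^\<^sub>m j) $$ (p, c)", OF norm_pow_mat_index_le, OF T that rc(2), of l 1] by simp
  have "(T * mat_fun (phi (Suc m)) T) $$ (r, c)
      = (\<Sum>p<k. T $$ (r, p) * (\<Sum>j. 1 / fact (j + Suc m) * (T ^\<^sub>m j) $$ (p, c)))"
    by (simp add: mult_mat_index_sum[OF T mat_fun_carrier[OF T] rc] idx del: fact_Suc)
  \<comment> \<open>The finite sum over \<open>p\<close> may be exchanged with the series because
    every entry series converges.\<close>
  also have "\<dots> = (\<Sum>j. \<Sum>p<k. T $$ (r, p) * (1 / fact (j + Suc m) * (T ^\<^sub>m j) $$ (p, c)))"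
    by (subst suminf_sum) (auto intro!: sum.cong suminf_mult[symmetric] summable_mult
        summable[where l = "Suc m", unfolded add_Suc_right] simp del: fact_Suc times_divide_eq_left)
  also have "\<dots> = (\<Sum>j. 1 / fact (Suc j + m) * (T ^\<^sub>m Suc j) $$ (r, c))"
    by (simp add: pow_mat_Suc_left[OF T] mult_mat_index_sum[OF T pow_carrier_mat[OF T] rc]
        sum_divide_distrib del: fact_Suc pow_mat.simps)
  also have "\<dots> = mat_fun (phi m) T $$ (r, c) - 1 / fact m * (1\<^sub>m k) $$ (r, c)"
    using suminf_split_head[OF summable[OF rc(1), of m]] T rc by (simp add: idx del: fact_Suc pow_mat.simps(2))
  finally show "mat_fun (phi m) T $$ (r, c)
      = ((1 / fact m) \<cdot>\<^sub>m 1\<^sub>m k + T * mat_fun (phi (Suc m)) T) $$ (r, c)"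
    using T rc by simp
qed (use T in \<open>auto simp: mat_fun_def\<close>)

lemma mat_fun_phi_index_deriv:
  fixes t :: real
  assumes T: "T \<in> carrier_mat k k" and rc: "r < k" "c < k" and "t \<noteq> 0"
  shows "((\<lambda>s. mat_fun (phi (Suc m)) (of_real (- s) \<cdot>\<^sub>m T) $$ (r, c)) has_vector_derivative
    (mat_fun (phi m) (of_real (- t) \<cdot>\<^sub>m T) $$ (r, c)
      - of_nat (Suc m) * mat_fun (phi (Suc m)) (of_real (- t) \<cdot>\<^sub>m T) $$ (r, c)) / of_real t) (at t)"
proof -
  define S where "S = (\<lambda>l x. \<Sum>j. 1 / fact (j + l) * (T ^\<^sub>m j) $$ (r, c) * x ^ j)"
  have idx: "mat_fun (phi l) (x \<cdot>\<^sub>m T) $$ (r, c) = S l x" for l x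
    unfolding S_def by (rule mat_fun_phi_index[OF T rc])
  have "(S (Suc m) has_field_derivative (S m (- of_real t) - of_nat (Suc m) * S (Suc m) (- of_real t))
      / (- of_real t)) (at (- of_real t))"
    unfolding S_def using \<open>t \<noteq> 0\<close>
    by (intro phi_series_deriv[OF norm_pow_mat_index_le[OF T rc]]) auto
  \<comment> \<open>The inner derivative -1 cancels the sign of the denominator
    \<open>- of_real t\<close>.\<close>
  then have "((\<lambda>w. S (Suc m) (- w)) has_field_derivative
      (S m (- of_real t) - of_nat (Suc m) * S (Suc m) (- of_real t)) / of_real t) (at (of_real t))"
    using DERIV_chain2[OF _ DERIV_minus[OF DERIV_ident], of "S (Suc m)"] by fastforce
  from has_vector_derivative_real_field[OF this] show ?thesis
    by (simp add: idx)
qed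

text \<open>\<open>V\<close> and \<open>b\<close> are constant, so each component is a fixed linear
  combination of entries of the matrix function, and \<open>mat_fun_phi_index_deriv\<close> carries
  over by linearity.\<close>

lemma vec_deriv_mat_fun_phi:
  fixes t :: real
  assumes T: "T \<in> carrier_mat k k" and V: "V \<in> carrier_mat n k" and b: "b \<in> carrier_vec k"
    and "t \<noteq> 0"
  shows "vec_deriv (\<lambda>s. V *\<^sub>v (mat_fun (phi (Suc m)) (of_real (- s) \<cdot>\<^sub>m T) *\<^sub>v b)) t
    = of_real (1 / t) \<cdot>\<^sub>v (V *\<^sub>v (mat_fun (phi m) (of_real (- t) \<cdot>\<^sub>m T) *\<^sub>v b)
      - of_nat (Suc m) \<cdot>\<^sub>v (V *\<^sub>v (mat_fun (phi (Suc m)) (of_real (- t) \<cdot>\<^sub>m T) *\<^sub>v b)))"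
    (is "vec_deriv ?y t = ?R")
proof (rule eq_vecI)
  fix i assume "i < dim_vec ?R"
  then have i: "i < n" using V by simp
  let ?P = "\<lambda>l s. mat_fun (phi l) (of_real (- s) \<cdot>\<^sub>m T)"
  have P: "?P l s \<in> carrier_mat k k" for l s
    using T by simp
  have idx: "(V *\<^sub>v (?P l s *\<^sub>v b)) $ i
      = (\<Sum>r<k. V $$ (i, r) * (\<Sum>c<k. ?P l s $$ (r, c) * b $ c))" for l s
    using mult_mat_vec_index_sum[OF V mult_mat_vec_carrier[OF P b] i, of l s]
      mult_mat_vec_index_sum[OF P b] by simp
  have "((\<lambda>s. ?y s $ i) has_vector_derivative (\<Sum>r<k. V $$ (i, r) * (\<Sum>c<k.
      (?P m t $$ (r, c) - of_nat (Suc m) * ?P (Suc m) t $$ (r, c)) / of_real t * b $ c))) (at t)"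
    unfolding idx
    by (intro has_vector_derivative_sum has_vector_derivative_mult_right
        has_vector_derivative_mult_left mat_fun_phi_index_deriv[OF T]) (use \<open>t \<noteq> 0\<close> in auto)
  also have "(\<Sum>r<k. V $$ (i, r) * (\<Sum>c<k.
      (?P m t $$ (r, c) - of_nat (Suc m) * ?P (Suc m) t $$ (r, c)) / of_real t * b $ c))
      = 1 / of_real t * ((V *\<^sub>v (?P m t *\<^sub>v b)) $ i - of_nat (Suc m) * (V *\<^sub>v (?P (Suc m) t *\<^sub>v b)) $ i)"
    unfolding idx sum_distrib_left sum_subtractf[symmetric]
    by (intro sum.cong refl) (simp add: field_simps diff_divide_distrib)
  finally have "vector_derivative (\<lambda>s. ?y s $ i) (at t) = ?R $ i"
    using V i by (subst vector_derivative_at) auto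
  then show "vec_deriv ?y t $ i = ?R $ i"
    using V i by (simp only: vec_deriv_def index_vec) simp
qed (use V in \<open>auto simp: vec_deriv_def\<close>)

subsection \<open>Adjoints and orthonormal columns\<close>

lemma outer_prod_carrier [simp]:
  "u \<in> carrier_vec p \<Longrightarrow> w \<in> carrier_vec q \<Longrightarrow> outer_prod u w \<in> carrier_mat p q"
  by (simp add: outer_prod_def)

lemma outer_prod_mult_vec:
  assumes "u \<in> carrier_vec p" "w \<in> carrier_vec q" "x \<in> carrier_vec q"
  shows "outer_prod u w *\<^sub>v x = (x \<bullet>c w) \<cdot>\<^sub>v u"
  using assms
  by (intro eq_vecI) (auto simp: outer_prod_def scalar_prod_def sum_distrib_left mult_ac)

lemma append_col_dim [simp]:
  "dim_row (append_col V w) = dim_row V" "dim_col (append_col V w) = Suc (dim_col V)"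
  by (simp_all add: append_col_def)

lemma append_col_carrier [simp]: "V \<in> carrier_mat n k \<Longrightarrow> append_col V w \<in> carrier_mat n (Suc k)"
  by auto

lemma append_col_index:
  assumes "V \<in> carrier_mat n k" "i < n" "j < Suc k"
  shows "append_col V w $$ (i, j) = (if j < k then V $$ (i, j) else w $ i)"
  using assms by (auto simp: append_col_def mat_of_cols_def nth_append less_Suc_eq)

text \<open>Block multiplication: this turns the stacked vector of the residual formula into the sum
  used in the computation.\<close>

lemma append_col_mult_vec:
  assumes V: "V \<in> carrier_mat n k" and w: "w \<in> carrier_vec n" and a: "a \<in> carrier_vec k"
  shows "append_col V w *\<^sub>v (a @\<^sub>v vec_of_list [c]) = V *\<^sub>v a + c \<cdot>\<^sub>v w"
proof (rule eq_vecI)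
  fix i assume "i < dim_vec (V *\<^sub>v a + c \<cdot>\<^sub>v w)"
  then have i: "i < n" using w by simp
  have a': "a @\<^sub>v vec_of_list [c] \<in> carrier_vec (Suc k)"
    using a by (intro carrier_vecI) simp
  show "(append_col V w *\<^sub>v (a @\<^sub>v vec_of_list [c])) $ i = (V *\<^sub>v a + c \<cdot>\<^sub>v w) $ i"
    unfolding mult_mat_vec_index_sum[OF append_col_carrier[OF V] a' i]
    using V w a i
    by (simp add: mult_mat_vec_index_sum[OF V a i] append_col_index[OF V] del: index_mult_mat_vec)
qed (use V w in auto)

lemma col_append_col:
  assumes "V \<in> carrier_mat n k" "w \<in> carrier_vec n" "j < Suc k"
  shows "col (append_col V w) j = (if j < k then col V j else w)"
proof (rule eq_vecI)
  fix i assume "i < dim_vec (if j < k then col V j else w)"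
  then have "i < n" using assms by (auto split: if_splits)
  then show "col (append_col V w) j $ i = (if j < k then col V j else w) $ i"
    using assms append_col_index[OF assms(1), of i j w] by auto
qed (use assms in auto)

section \<open>Conjugate transposes\<close>

lemma mat_adjoint_dim [simp]:
  "dim_row (mat_adjoint X) = dim_col X" "dim_col (mat_adjoint X) = dim_row X"
  by (simp_all add: mat_adjoint_def)

lemma mat_adjoint_carrier [simp]: "X \<in> carrier_mat p q \<Longrightarrow> mat_adjoint X \<in> carrier_mat q p"
  by auto

lemma mat_adjoint_index [simp]:
  "i < dim_col X \<Longrightarrow> j < dim_row X \<Longrightarrow> mat_adjoint X $$ (i, j) = conjugate (X $$ (j, i))"
  by (simp add: mat_adjoint_def mat_of_rows_def)

lemma mat_adjoint_add:
  "X \<in> carrier_mat p q \<Longrightarrow> Y \<in> carrier_mat p q \<Longrightarrow> mat_adjoint (X + Y) = mat_adjoint X + mat_adjoint Y"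
  by (rule eq_matI) (auto simp: conjugate_dist_add)

lemma mat_adjoint_smult: "mat_adjoint (c \<cdot>\<^sub>m X) = conjugate c \<cdot>\<^sub>m mat_adjoint X"
  by (rule eq_matI) (auto simp: conjugate_dist_mul)

lemma mat_adjoint_mult:
  fixes X Y :: "complex mat"
  assumes "X \<in> carrier_mat p q" "Y \<in> carrier_mat q s"
  shows "mat_adjoint (X * Y) = mat_adjoint Y * mat_adjoint X"
  by (rule eq_matI) (use assms in \<open>auto simp: scalar_prod_def mult.commute intro!: sum.cong\<close>)

lemma mat_adjoint_one: "mat_adjoint (1\<^sub>m k :: complex mat) = 1\<^sub>m k"
  by (rule eq_matI) auto

lemma mat_adjoint_outer_prod: "mat_adjoint (outer_prod u w) = outer_prod w u"
  by (rule eq_matI) (auto simp: outer_prod_def)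

lemma mat_adjoint_mult_vec_index:
  fixes X :: "complex mat"
  assumes "X \<in> carrier_mat p q" "z \<in> carrier_vec p" "i < q"
  shows "(mat_adjoint X *\<^sub>v z) $ i = z \<bullet>c col X i"
  using assms by (auto simp: scalar_prod_def mult.commute intro!: sum.cong)

text \<open>These are the four blocks of the Gram matrix of \<open>[V, w]\<close>, where column
  index \<open>k\<close> stands for \<open>w\<close>. The last block is applied to a vector
  \<open>x\<close>, the form needed for \<open>z \<bullet>c w\<close>.\<close>

lemma orthonormal_append_colD:
  assumes V: "V \<in> carrier_mat n k" and w: "w \<in> carrier_vec n"
    and orth: "orthonormal_cols (append_col V w)"
  shows "mat_adjoint V * V = 1\<^sub>m k" "mat_adjoint V *\<^sub>v w = 0\<^sub>v k" "w \<bullet>c w = 1"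
    "x \<in> carrier_vec k \<Longrightarrow> (V *\<^sub>v x) \<bullet>c w = 0"
proof -
  have *: "col (append_col V w) i \<bullet>c col (append_col V w) j = (if i = j then 1 else 0)"
    if "i < Suc k" "j < Suc k" for i j
    using orth that append_col_carrier[OF V, of w] by (auto simp: orthonormal_cols_def)
  note col = col_append_col[OF V w]
  have VV: "col V i \<bullet>c col V j = (if i = j then 1 else 0)" if "i < k" "j < k" for i j
    using *[of i j] that by (simp add: col)
  have wV: "w \<bullet>c col V j = 0" if "j < k" for j
    using *[of k j] that by (simp add: col)
  have Vw: "col V j \<bullet>c w = 0" if "j < k" for j
    using *[of j k] that by (simp add: col)
  show "w \<bullet>c w = 1"
    using *[of k k] by (simp add: col)
  show "mat_adjoint V *\<^sub>v w = 0\<^sub>v k"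
    by (rule eq_vecI) (use V w wV mat_adjoint_mult_vec_index[OF V w] in auto)
  show "mat_adjoint V * V = 1\<^sub>m k"
  proof (rule eq_matI)
    fix i j assume "i < dim_row (1\<^sub>m k :: complex mat)" "j < dim_col (1\<^sub>m k :: complex mat)"
    then have ij: "i < k" "j < k" by auto
    have "(mat_adjoint V * V) $$ (i, j) = (mat_adjoint V *\<^sub>v col V j) $ i"
      using V ij by simp
    also have "\<dots> = col V j \<bullet>c col V i"
      using V ij by (intro mat_adjoint_mult_vec_index) auto
    finally show "(mat_adjoint V * V) $$ (i, j) = (1\<^sub>m k :: complex mat) $$ (i, j)"
      using VV ij by auto
  qed (use V in auto)
  show "(V *\<^sub>v x) \<bullet>c w = 0" if x: "x \<in> carrier_vec k"
  proof -
    have "(V *\<^sub>v x) \<bullet>c w = (\<Sum>i<n. \<Sum>j<k. V $$ (i, j) * x $ j * cnj (w $ i))"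
      using V w x by (simp add: scalar_prod_def lessThan_atLeast0 sum_distrib_right)
    also have "\<dots> = (\<Sum>j<k. x $ j * (col V j \<bullet>c w))"
      using V w by (subst sum.swap) (auto simp: scalar_prod_def lessThan_atLeast0 sum_distrib_left mult_ac intro!: sum.cong)
    finally show ?thesis by (simp add: Vw)
  qed
qed

text \<open>The adjoint of an inverse of \<open>G\<close> inverts the adjoint of \<open>G\<close>.
  Hence \<open>mat_inverse\<close> returns a \<open>Some\<close> value, and \<open>the\<close> in
  \<open>inv_adjoint\<close> is meaningful.\<close>

lemma inv_adjoint_props:
  assumes G: "G \<in> carrier_mat k k" and "invertible_mat G"
  shows "inv_adjoint G \<in> carrier_mat k k" "mat_adjoint G * inv_adjoint G = 1\<^sub>m k"
proof -
  obtain B where "G * B = 1\<^sub>m k" "B * G = 1\<^sub>m (dim_row B)"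
    using assms by (auto simp: invertible_mat_def inverts_mat_def)
  \<comment> \<open>\<open>inverts_mat\<close> does not fix the dimensions of \<open>B\<close>; they
    are read off from the two products.\<close>
  moreover from this have B: "B \<in> carrier_mat k k"
    using G by (metis carrier_matI carrier_matD(2) index_mult_mat(2,3) index_one_mat(2,3))
  ultimately have "mat_adjoint B * mat_adjoint G = 1\<^sub>m k" "mat_adjoint G * mat_adjoint B = 1\<^sub>m k"
    using G by (auto simp: mat_adjoint_mult[symmetric] mat_adjoint_one)
  \<comment> \<open>Being a unit of the matrix ring is what excludes the result
    \<open>None\<close>.\<close>
  then have "mat_adjoint G \<in> Units (ring_mat TYPE(complex) k ())"
    using G B by (auto simp: Units_def ring_mat_simps intro!: bexI[of _ "mat_adjoint B"])
  then obtain C where C: "mat_inverse (mat_adjoint G) = Some C"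
    using mat_inverse(1)[OF mat_adjoint_carrier[OF G], where b = "()"] by auto
  then show "inv_adjoint G \<in> carrier_mat k k" "mat_adjoint G * inv_adjoint G = 1\<^sub>m k"
    using mat_inverse(2)[OF mat_adjoint_carrier[OF G] C] by (auto simp: inv_adjoint_def)
qed

lemma smult_mat_mult_vec:
  fixes X :: "'a :: comm_semiring_1 mat"
  assumes "X \<in> carrier_mat p q" "x \<in> carrier_vec q"
  shows "(c \<cdot>\<^sub>m X) *\<^sub>v x = c \<cdot>\<^sub>v (X *\<^sub>v x)"
  by (rule eq_vecI) (use assms in \<open>auto simp: scalar_prod_def sum_distrib_left mult_ac\<close>)

subsection \<open>The residual\<close>

theorem proposition3p1:
  fixes n k l :: nat
    and A V H T M :: "complex mat"
    and v w e1 ek :: "complex vec"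
    and t \<beta> h \<gamma> :: real
    and y r :: "real \<Rightarrow> complex vec"
  assumes A: "A \<in> carrier_mat n n"
    and t: "t > 0"
    and spec: "\<forall>z\<in>spectrum (of_real (- t) \<cdot>\<^sub>m A). Re z \<le> 0"
    and v: "v \<in> carrier_vec n" "v \<noteq> 0\<^sub>v n"
    and \<beta>: "\<beta> = vec_l2norm v"
    and arnoldi: "arnoldi A (of_real (1 / \<beta>) \<cdot>\<^sub>v v) k V w H h"
    and e1: "e1 = unit_vec k 0"
    and ek: "ek = unit_vec k (k - 1)"
    and \<gamma>: "\<gamma> \<noteq> 0"
    and nonsingular: "invertible_mat (1\<^sub>m k + of_real \<gamma> \<cdot>\<^sub>m H)"
    and M: "M = inv_adjoint (1\<^sub>m k + of_real \<gamma> \<cdot>\<^sub>m H)"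
    and T: "T = H + of_real (\<gamma> * h\<^sup>2) \<cdot>\<^sub>m (M * outer_prod ek ek)"
    and l: "l \<ge> 1"
    and y: "\<And>s. y s =
      V *\<^sub>v (mat_fun (phi l) (of_real (- s) \<cdot>\<^sub>m T) *\<^sub>v (of_real \<beta> \<cdot>\<^sub>v e1))"
    and r: "\<And>s. r s =
      - (A *\<^sub>v y s) - of_real (real l / s) \<cdot>\<^sub>v y s
      + of_real (1 / (s * fact (l - 1))) \<cdot>\<^sub>v v - vec_deriv y s"
  shows "r t = of_real (1 / t) \<cdot>\<^sub>v
           (of_real (- t) \<cdot>\<^sub>v
              (A *\<^sub>v (V *\<^sub>v (mat_fun (phi l) (of_real (- t) \<cdot>\<^sub>m T) *\<^sub>v (of_real \<beta> \<cdot>\<^sub>v e1))))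
            - V *\<^sub>v (mat_fun (phi (l - 1)) (of_real (- t) \<cdot>\<^sub>m T) *\<^sub>v (of_real \<beta> \<cdot>\<^sub>v e1))
            + of_real (1 / fact (l - 1)) \<cdot>\<^sub>v (V *\<^sub>v (of_real \<beta> \<cdot>\<^sub>v e1)))
    \<and> r t = ((mat_fun (phi l) (of_real (- t) \<cdot>\<^sub>m T) *\<^sub>v (of_real \<beta> \<cdot>\<^sub>v e1)) \<bullet>c ek) \<cdot>\<^sub>v
           (append_col V w *\<^sub>v
              ((of_real (\<gamma> * h\<^sup>2) \<cdot>\<^sub>v (M *\<^sub>v ek)) @\<^sub>v vec_of_list [- of_real h]))
    \<and> mat_adjoint ((1\<^sub>m n + of_real \<gamma> \<cdot>\<^sub>m A) * V) *\<^sub>v r t = 0\<^sub>v k"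
proof -
  have k: "1 \<le> k" and V: "V \<in> carrier_mat n k" and w: "w \<in> carrier_vec n" and H: "H \<in> carrier_mat k k"
    and V0: "col V 0 = of_real (1 / \<beta>) \<cdot>\<^sub>v v"
    and orth: "orthonormal_cols (append_col V w)"
    and AV: "A * V = V * H + of_real h \<cdot>\<^sub>m outer_prod w ek"
    using arnoldi A by (auto simp: arnoldi_def ek)
  note orthD = orthonormal_append_colD[OF V w orth]
  define G where "G = 1\<^sub>m k + of_real \<gamma> \<cdot>\<^sub>m H"
  have G: "G \<in> carrier_mat k k"
    using H by (simp add: G_def)
  have Mc: "M \<in> carrier_mat k k" and GM: "mat_adjoint G * M = 1\<^sub>m k"
    using inv_adjoint_props[OF G] nonsingular by (simp_all add: G_def M)
  have ekc: "ek \<in> carrier_vec k"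
    by (simp add: ek)
  have Tc: "T \<in> carrier_mat k k"
    using H Mc ekc by (simp add: T)
  define b where "b = of_real \<beta> \<cdot>\<^sub>v e1"
  have b: "b \<in> carrier_vec k"
    by (simp add: b_def e1)
  define P where "P = (\<lambda>l. mat_fun (phi l) (of_real (- t) \<cdot>\<^sub>m T))"
  have P: "P i \<in> carrier_mat k k" for i
    using Tc by (simp add: P_def)
  obtain m where m: "l = Suc m"
    using l by (cases l) auto
  \<comment> \<open>\<open>x\<close> holds the coordinates of \<open>y t\<close> with respect to the
    columns of \<open>V\<close>; its last coordinate \<open>c\<close> is the scalar factor in the
    residual.\<close>
  define x where "x = P l *\<^sub>v b"
  have x: "x \<in> carrier_vec k"
    unfolding x_def by (rule mult_mat_vec_carrier[OF P b])
  define c where "c = x \<bullet>c ek"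
  have Mek: "M *\<^sub>v ek \<in> carrier_vec k"
    using Mc ekc by simp
  \<comment> \<open>This allows the normalisation of the first Arnoldi vector to be undone, giving
    \<open>V *\<^sub>v b = v\<close>.\<close>
  have "\<beta> \<noteq> 0"
  proof
    assume "\<beta> = 0"
    then have "\<forall>i<n. v $ i = 0"
      using v by (auto simp: \<beta> vec_l2norm_def L2_set_eq_0_iff)
    then have "v = 0\<^sub>v n"
      using v by (intro eq_vecI) auto
    with v show False by simp
  qed
  have Vb: "V *\<^sub>v b = v"
  proof -
    have "V *\<^sub>v e1 = col V 0"
      using V k by (intro eq_vecI) (auto simp: e1)
    moreover have "V *\<^sub>v b = of_real \<beta> \<cdot>\<^sub>v (V *\<^sub>v e1)"
      unfolding b_def using V by (intro mult_mat_vec) (auto simp: e1)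
    ultimately show ?thesis
      using \<open>\<beta> \<noteq> 0\<close> by (simp add: V0 smult_smult_assoc)
  qed
  have Tx: "T *\<^sub>v x = H *\<^sub>v x + (of_real (\<gamma> * h\<^sup>2) * c) \<cdot>\<^sub>v (M *\<^sub>v ek)"
  proof -
    have "(M * outer_prod ek ek) *\<^sub>v x = c \<cdot>\<^sub>v (M *\<^sub>v ek)"
      using assoc_mult_mat_vec[OF Mc outer_prod_carrier[OF ekc ekc] x] mult_mat_vec[OF Mc ekc]
      by (simp add: outer_prod_mult_vec[OF ekc ekc x] c_def)
    moreover have Mo: "M * outer_prod ek ek \<in> carrier_mat k k"
      using Mc ekc by simp
    ultimately show ?thesis
      unfolding T using add_mult_distrib_mat_vec[OF H smult_carrier_mat[OF Mo] x]
      by (simp add: smult_mat_mult_vec[OF Mo x] smult_smult_assoc)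
  qed
  \<comment> \<open>The recurrence at -tT, applied to \<open>b\<close>, expresses the term with
    index \<open>l - 1\<close> through \<open>x\<close>.\<close>
  have p: "P m *\<^sub>v b = (1 / fact m) \<cdot>\<^sub>v b + of_real (- t) \<cdot>\<^sub>v (T *\<^sub>v x)"
  proof -
    have "P m = (1 / fact m) \<cdot>\<^sub>m 1\<^sub>m k + (of_real (- t) \<cdot>\<^sub>m T) * P l"
      unfolding P_def m by (rule mat_fun_phi_rec) (use Tc in simp)
    then have "P m *\<^sub>v b = (1 / fact m) \<cdot>\<^sub>m 1\<^sub>m k *\<^sub>v b + (of_real (- t) \<cdot>\<^sub>m T) * P l *\<^sub>v b"
      using add_mult_distrib_mat_vec[OF _ mult_carrier_mat[OF smult_carrier_mat[OF Tc] P] b] by simp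
    also have "(1 / fact m) \<cdot>\<^sub>m 1\<^sub>m k *\<^sub>v b = (1 / fact m) \<cdot>\<^sub>v b"
      using b by (simp add: smult_mat_mult_vec[OF one_carrier_mat b])
    also have "(of_real (- t) \<cdot>\<^sub>m T) * P l *\<^sub>v b = of_real (- t) \<cdot>\<^sub>v (T *\<^sub>v x)"
      using assoc_mult_mat_vec[OF smult_carrier_mat[OF Tc] P b] smult_mat_mult_vec[OF Tc x]
      by (simp add: x_def)
    finally show ?thesis .
  qed
  have Vp: "V *\<^sub>v (P m *\<^sub>v b) = (1 / fact m) \<cdot>\<^sub>v v
      + of_real (- t) \<cdot>\<^sub>v (V *\<^sub>v (H *\<^sub>v x) + (of_real (\<gamma> * h\<^sup>2) * c) \<cdot>\<^sub>v (V *\<^sub>v (M *\<^sub>v ek)))"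
    unfolding p Tx using V H x Mek b Vb
    by (simp add: mult_add_distrib_mat_vec[OF V] mult_mat_vec[OF V])
  have Ax: "A *\<^sub>v (V *\<^sub>v x) = V *\<^sub>v (H *\<^sub>v x) + (of_real h * c) \<cdot>\<^sub>v w"
  proof -
    have o: "outer_prod w ek \<in> carrier_mat n k"
      using w ekc by simp
    have "A *\<^sub>v (V *\<^sub>v x) = A * V *\<^sub>v x"
      using A V x by simp
    also have "\<dots> = V * H *\<^sub>v x + (of_real h \<cdot>\<^sub>m outer_prod w ek) *\<^sub>v x"
      unfolding AV using V H x o by (intro add_mult_distrib_mat_vec) auto
    also have "\<dots> = V *\<^sub>v (H *\<^sub>v x) + (of_real h * c) \<cdot>\<^sub>v w"
      using V H x by (simp add: smult_mat_mult_vec[OF o x] outer_prod_mult_vec[OF w ekc x] c_def smult_smult_assoc)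
    finally show ?thesis .
  qed
  have yt: "y t = V *\<^sub>v x"
    by (simp add: y x_def P_def b_def)
  \<comment> \<open>\<open>vec_deriv\<close> depends on \<open>y\<close> as a function of
    \<open>s\<close>, so the pointwise equation is lifted to functions.\<close>
  have "y = (\<lambda>s. V *\<^sub>v (mat_fun (phi (Suc m)) (of_real (- s) \<cdot>\<^sub>m T) *\<^sub>v b))"
    by (rule ext) (simp only: y m b_def)
  then have "vec_deriv y t = of_real (1 / t) \<cdot>\<^sub>v (V *\<^sub>v (P m *\<^sub>v b) - of_nat l \<cdot>\<^sub>v (V *\<^sub>v x))"
    using vec_deriv_mat_fun_phi[OF Tc V b, of t m] t by (simp only: P_def x_def m)
  then have rt: "r t = - (A *\<^sub>v (V *\<^sub>v x)) - of_real (real l / t) \<cdot>\<^sub>v (V *\<^sub>v x)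
      + of_real (1 / (t * fact m)) \<cdot>\<^sub>v v
      - of_real (1 / t) \<cdot>\<^sub>v (V *\<^sub>v (P m *\<^sub>v b) - of_nat l \<cdot>\<^sub>v (V *\<^sub>v x))"
    by (simp add: r yt m)
  have carr: "A *\<^sub>v (V *\<^sub>v x) \<in> carrier_vec n" "V *\<^sub>v x \<in> carrier_vec n" "V *\<^sub>v (P m *\<^sub>v b) \<in> carrier_vec n"
    "V *\<^sub>v (H *\<^sub>v x) \<in> carrier_vec n" "V *\<^sub>v (M *\<^sub>v ek) \<in> carrier_vec n"
    by (rule mult_mat_vec_carrier[OF A mult_mat_vec_carrier[OF V x]]
        mult_mat_vec_carrier[OF V] x mult_mat_vec_carrier[OF P b] mult_mat_vec_carrier[OF H x] Mek)+
  \<comment> \<open>The derivative contributes + (l/t) y, which cancels the term - (l/t) y of the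
    residual. The identity is proved for arbitrary vectors so that their entries stay
    atomic.\<close>
  have first: "r t = of_real (1 / t) \<cdot>\<^sub>v (of_real (- t) \<cdot>\<^sub>v (A *\<^sub>v (V *\<^sub>v x))
      - V *\<^sub>v (P m *\<^sub>v b) + of_real (1 / fact m) \<cdot>\<^sub>v v)"
  proof -
    have "- a - of_real (real l / t) \<cdot>\<^sub>v u + of_real (1 / (t * fact m)) \<cdot>\<^sub>v v
        - of_real (1 / t) \<cdot>\<^sub>v (q - of_nat l \<cdot>\<^sub>v u)
      = of_real (1 / t) \<cdot>\<^sub>v (of_real (- t) \<cdot>\<^sub>v a - q + of_real (1 / fact m) \<cdot>\<^sub>v v)"
      if "a \<in> carrier_vec n" "u \<in> carrier_vec n" "q \<in> carrier_vec n" for a u q :: "complex vec"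
      using that v(1) t by (intro eq_vecI) (auto simp: field_simps)
    from this[OF carr(1-3)] show ?thesis
      unfolding rt .
  qed
  \<comment> \<open>Here \<open>a\<close> stands for V H x, which occurs in both A V x and V T x and
    cancels, as do the multiples of \<open>v\<close>. Both surviving terms carry the factor
    \<open>c\<close>.\<close>
  have second: "r t = c \<cdot>\<^sub>v (of_real (\<gamma> * h\<^sup>2) \<cdot>\<^sub>v (V *\<^sub>v (M *\<^sub>v ek)) + (- of_real h) \<cdot>\<^sub>v w)"
  proof -
    have "of_real (1 / t) \<cdot>\<^sub>v (of_real (- t) \<cdot>\<^sub>v (a + (of_real h * c) \<cdot>\<^sub>v w)
        - ((1 / fact m) \<cdot>\<^sub>v v + of_real (- t) \<cdot>\<^sub>v (a + (of_real (\<gamma> * h\<^sup>2) * c) \<cdot>\<^sub>v u))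
        + of_real (1 / fact m) \<cdot>\<^sub>v v)
      = c \<cdot>\<^sub>v (of_real (\<gamma> * h\<^sup>2) \<cdot>\<^sub>v u + (- of_real h) \<cdot>\<^sub>v w)"
      if "a \<in> carrier_vec n" "u \<in> carrier_vec n" for a u
      using that v(1) w t by (intro eq_vecI) (auto simp: field_simps)
    from this[OF carr(4-5)] show ?thesis
      unfolding first Vp Ax .
  qed
  have "(1\<^sub>m n + of_real \<gamma> \<cdot>\<^sub>m A) * V = V * G + of_real (\<gamma> * h) \<cdot>\<^sub>m outer_prod w ek"
    (is "?W = _")
  proof -
    have o: "outer_prod w ek \<in> carrier_mat n k"
      using w ekc by simp
    have "?W = V + of_real \<gamma> \<cdot>\<^sub>m (A * V)"
      using A V by (simp add: add_mult_distrib_mat[of _ n n] mult_smult_assoc_mat[of _ n n])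
    moreover have "V * G = V + of_real \<gamma> \<cdot>\<^sub>m (V * H)"
      using V by (simp add: G_def mult_add_distrib_mat[OF V one_carrier_mat smult_carrier_mat[OF H]]
          mult_smult_distrib[OF V H])
    ultimately show ?thesis
      unfolding AV using V H o by (intro eq_matI) (auto simp: algebra_simps simp del: index_mult_mat(1))
  qed
  \<comment> \<open>Conjugation leaves the coefficient unchanged because \<gamma> and
    \<open>h\<close> are real.\<close>
  then have W: "mat_adjoint ?W = mat_adjoint G * mat_adjoint V + of_real (\<gamma> * h) \<cdot>\<^sub>m outer_prod ek w"
    using V G w ekc
    by (simp add: mat_adjoint_add[of _ n k] mat_adjoint_mult[of _ n k _ k] mat_adjoint_smult mat_adjoint_outer_prod)
  have third: "mat_adjoint ?W *\<^sub>v r t = 0\<^sub>v k"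
  proof -
    have smult0: "a \<cdot>\<^sub>v 0\<^sub>v k = 0\<^sub>v k" for a :: complex
      by (rule eq_vecI) auto
    \<comment> \<open>\<open>z\<close> is the direction of the residual, without the scalar
      \<open>c\<close>; it suffices that the adjoint annihilates \<open>z\<close>.\<close>
    define z where "z = of_real (\<gamma> * h\<^sup>2) \<cdot>\<^sub>v (V *\<^sub>v (M *\<^sub>v ek)) + (- of_real h) \<cdot>\<^sub>v w"
    have z: "z \<in> carrier_vec n"
      using carr w by (simp add: z_def)
    have aV: "mat_adjoint V \<in> carrier_mat k n" and aG: "mat_adjoint G \<in> carrier_mat k k"
      and o: "outer_prod ek w \<in> carrier_mat k n"
      using V G w ekc by simp_all
    have "mat_adjoint V *\<^sub>v z = of_real (\<gamma> * h\<^sup>2) \<cdot>\<^sub>v (mat_adjoint V *\<^sub>v (V *\<^sub>v (M *\<^sub>v ek)))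
        + (- of_real h) \<cdot>\<^sub>v (mat_adjoint V *\<^sub>v w)"
      unfolding z_def using carr w
      by (simp add: mult_add_distrib_mat_vec[OF aV] mult_mat_vec[OF aV])
    also have "mat_adjoint V *\<^sub>v (V *\<^sub>v (M *\<^sub>v ek)) = M *\<^sub>v ek"
      using assoc_mult_mat_vec[OF aV V Mek] orthD(1) Mek by simp
    finally have "mat_adjoint V *\<^sub>v z = of_real (\<gamma> * h\<^sup>2) \<cdot>\<^sub>v (M *\<^sub>v ek)"
      using Mek by (simp add: orthD(2) smult0)
    \<comment> \<open>The factor \<open>M\<close> in the correction of \<open>T\<close> serves this
      purpose: the adjoint of \<open>G\<close> undoes it and leaves a multiple of
      \<open>ek\<close>.\<close>
    then have 1: "mat_adjoint G * mat_adjoint V *\<^sub>v z = of_real (\<gamma> * h\<^sup>2) \<cdot>\<^sub>v ek"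
      using assoc_mult_mat_vec[OF aG aV z] assoc_mult_mat_vec[OF aG Mc ekc] ekc GM mult_mat_vec[OF aG Mek]
      by simp
    have "z \<bullet>c w = of_real (\<gamma> * h\<^sup>2) * ((V *\<^sub>v (M *\<^sub>v ek)) \<bullet>c w) + (- of_real h) * (w \<bullet>c w)"
      unfolding z_def using carr w by (simp add: add_scalar_prod_distrib[of _ n])
    then have zw: "z \<bullet>c w = - of_real h"
      by (simp add: orthD(3) orthD(4)[OF Mek])
    have "mat_adjoint ?W *\<^sub>v z = of_real (\<gamma> * h\<^sup>2) \<cdot>\<^sub>v ek + (of_real (\<gamma> * h) * (- of_real h)) \<cdot>\<^sub>v ek"
      unfolding W using aG aV o z
      by (simp add: add_mult_distrib_mat_vec[of _ k n] 1 smult_mat_mult_vec[OF o z]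
          outer_prod_mult_vec[OF ekc w z] zw smult_smult_assoc del: assoc_mult_mat_vec)
    also have "\<dots> = 0\<^sub>v k"
      using ekc by (intro eq_vecI) (auto simp: power2_eq_square)
    finally have 0: "mat_adjoint ?W *\<^sub>v z = 0\<^sub>v k" .
    have "mat_adjoint ?W \<in> carrier_mat k n"
      using A V by (intro mat_adjoint_carrier mult_carrier_mat add_carrier_mat smult_carrier_mat) auto
    from mult_mat_vec[OF this z] show ?thesis
      unfolding second z_def[symmetric] using 0 by (simp add: smult0)
  qed
  have "append_col V w *\<^sub>v ((of_real (\<gamma> * h\<^sup>2) \<cdot>\<^sub>v (M *\<^sub>v ek)) @\<^sub>v vec_of_list [- of_real h])
      = of_real (\<gamma> * h\<^sup>2) \<cdot>\<^sub>v (V *\<^sub>v (M *\<^sub>v ek)) + (- of_real h) \<cdot>\<^sub>v w"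
    using append_col_mult_vec[OF V w smult_carrier_vec[THEN iffD2, OF Mek]] mult_mat_vec[OF V Mek] by simp
  moreover have "l - 1 = m" and "mat_fun (phi l) (of_real (- t) \<cdot>\<^sub>m T) *\<^sub>v b = x"
    and "mat_fun (phi m) (of_real (- t) \<cdot>\<^sub>m T) *\<^sub>v b = P m *\<^sub>v b"
    by (simp_all add: m x_def P_def)
  ultimately show ?thesis
    unfolding b_def[symmetric] using first second third by (simp only: Vb c_def simp_thms)
qed

end
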